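(* Let $n \geq 1$, let $0 < m_1 < m_2 < \dots < m_n$ be natural numbers, let $a_1, \dots, a_n \in \mathbb{C}$, and let $$ f(t) = \sum_{k=1}^{n} a_k e^{i m_k t}, $$ regarded as a $2\pi$-periodic function, with $f \not\equiv 0$. Let $g(t) = |f(t)|$. Assume that $g$ attains its global maximum over a period at only finitely many distinct points $t_1, \dots, t_m \in [0, 2\pi)$, and that these maxima are non-degenerate, i.e. $g''(t_j) < 0$ for all $1 \leq j \leq m$. Then, as $\varepsilon \rightarrow 0^+$, $$\int_0^{2\pi} h_{\varepsilon}\left( \frac{f(t)}{\|f\|_{L^{\infty}}}\right) e^{it}\, dt = \frac{1}{\sqrt{\varepsilon}} \sum_{j=1}^m \frac{ \pi \cdot e^{i t_j}}{\sqrt{ - \frac{g''(t_j)}{2 \|g\|_{L^{\infty}}}}} + \mathcal{O}\left(\frac{1}{\varepsilon^{1/4}}\right),$$ where the implied constant may depend on $f$ but not on $\varepsilon$.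
   Context: For $0 < \varepsilon < 1$, the function $h_\varepsilon$ is defined by $$ h_{\varepsilon}(x) = \frac{1}{1 - (1-\varepsilon)|x|} \qquad \text{for } |x| \leq 1, $$ where $x$ may be complex and $|x|$ is its modulus. Thus $$ h_{\varepsilon}\left( \frac{f(t)}{\|f\|_{L^{\infty}}}\right) = \frac{1}{1 - (1-\varepsilon)\frac{|f(t)|}{\|f\|_{L^\infty}}}. $$ Here $\|f\|_{L^\infty} = \|g\|_{L^\infty} = \max_{t \in [0,2\pi]} |f(t)|$. The derivatives of $g$ are those of $g = |f|$ as a $2\pi$-periodic function on $\mathbb{R}$; $g$ is smooth near each $t_j$ because $f(t_j) \neq 0$. *)

theory Defs
  imports "HOL-Analysis.Analysis" "HOL-Library.Landau_Symbols"
begin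

(* Only meant for 0 < \<epsilon> < 1 and cmod x \<le> 1, where the denominator is positive. *)
definition h :: "real \<Rightarrow> complex \<Rightarrow> real" where
  "h \<epsilon> x = 1 / (1 - (1 - \<epsilon>) * cmod x)"

(* For a continuous 2 pi-periodic function the essential supremum over a period is the
   maximum over the compact interval [0, 2 pi].  For a function that is unbounded on this
   interval the value is unspecified. *)
definition Linf_norm :: "(real \<Rightarrow> 'a::real_normed_vector) \<Rightarrow> real" where
  "Linf_norm u = (SUP t\<in>{0..2*pi}. norm (u t))"

end

theory Submission
  imports Defs
begin

text \<open>
  Put \<open>N = Linf_norm f\<close> and \<open>F = 1 - g / N\<close>. The integrand is then exactly
  \<open>exp (\<i> t) / (\<epsilon> + (1 - \<epsilon>) * F t)\<close>, where \<open>F \<ge> 0\<close> vanishes at the maxima of \<open>g\<close> only. Nondegeneracy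
  makes \<open>F t\<close> equal to \<open>c * (t - y)\<^sup>2\<close> with \<open>c = - g''(y) / (2 N)\<close> up to a cubic error at each maximum \<open>y\<close>
  (\<open>norm_curve_expansion_at_maximum\<close>), so there the integrand resembles the Lorentzian
  \<open>exp (\<i> y) / (\<epsilon> + c * (t - y)\<^sup>2)\<close>, whose integral is \<open>pi * exp (\<i> y) / sqrt (c * \<epsilon>) + O(1)\<close> by an
  explicit arctangent.

  The integral is not split into neighbourhoods of the maxima. Instead the sum of all Lorentzians is
  subtracted from the integrand over the whole period, and the difference is bounded pointwise by a
  constant times \<open>1 + (\<Sum>y. \<bar>t - y\<bar> / (\<epsilon> + (t - y)\<^sup>2))\<close>, uniformly in \<open>\<epsilon>\<close>: this is a local claim
  (\<open>remainder_le_majorant_locally\<close>), which compactness globalises. Lemma \<open>majorant_le\<close> turns it into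
  an error of order \<open>\<epsilon> powr (-1/4)\<close> after integration.

  A maximum at \<open>0\<close> would lie on the boundary of \<open>[0, 2 pi]\<close>, so by periodicity the integral is first
  moved to a period that starts at a point where \<open>g\<close> is not maximal.
\<close>

section \<open>The Lorentzian integral\<close>

lemma reciprocal_quadratic_integral:
  fixes a b c y \<epsilon> :: real
  assumes "a \<le> b" "c > 0" "\<epsilon> > 0"
  shows "((\<lambda>t. 1 / (\<epsilon> + c * (t - y)\<^sup>2)) has_integral
           (arctan (sqrt (c / \<epsilon>) * (b - y)) - arctan (sqrt (c / \<epsilon>) * (a - y))) / sqrt (c * \<epsilon>)) {a..b}"
proof -
  define r where "r = sqrt (c / \<epsilon>)"
  have r: "r > 0" "r\<^sup>2 = c / \<epsilon>" using assms by (auto simp: r_def)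
  have re: "sqrt (c * \<epsilon>) = r * \<epsilon>"
    using assms by (simp add: r_def real_sqrt_divide real_sqrt_mult field_simps)
  have "((\<lambda>t. arctan (r * (t - y)) / (r * \<epsilon>)) has_vector_derivative 1 / (\<epsilon> + c * (t - y)\<^sup>2)) (at t within {a..b})" for t
  proof -
    have pos: "1 + (r * (t - y))\<^sup>2 > 0" by (simp add: add_pos_nonneg)
    have eq: "\<epsilon> + c * (t - y)\<^sup>2 = \<epsilon> * (1 + (r * (t - y))\<^sup>2)"
      unfolding power_mult_distrib r(2) using assms by (simp add: distrib_left)
    have "((\<lambda>t. arctan (r * (t - y)) / (r * \<epsilon>)) has_real_derivative
       (r * inverse (1 + (r * (t - y))\<^sup>2)) / (r * \<epsilon>)) (at t within {a..b})"
      using r(1) assms by (auto intro!: derivative_eq_intros)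
    also have "(r * inverse (1 + (r * (t - y))\<^sup>2)) / (r * \<epsilon>) = 1 / (\<epsilon> + c * (t - y)\<^sup>2)"
      unfolding eq using r(1) assms pos by (simp add: divide_inverse)
    finally show ?thesis by (simp add: has_real_derivative_iff_has_vector_derivative)
  qed
  from fundamental_theorem_of_calculus[OF assms(1) this]
  show ?thesis unfolding re r_def[symmetric] by (simp add: diff_divide_distrib)
qed

lemma arctan_defect: "u > 0 \<Longrightarrow> pi / 2 - arctan u \<le> 1 / u" for u :: real
proof -
  assume u: "u > 0"
  then have "pi / 2 - arctan u = arctan (1 / u)" using arctan_inverse[of u] by (simp add: inverse_eq_divide)
  then show ?thesis using u arctan_le_self[of "1 / u"] by simp
qed

text \<open>The integral over all of \<open>\<real>\<close> is \<open>pi / sqrt (c * \<epsilon>)\<close>; since the integrand is below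
  \<open>1 / (c * (t - y)\<^sup>2)\<close>, cutting off the tails beyond \<open>a\<close> and \<open>b\<close> changes it by an amount bounded
  uniformly in \<open>\<epsilon>\<close>.\<close>

lemma reciprocal_quadratic_integral_bounds:
  fixes a b c y \<epsilon> :: real
  assumes "a < y" "y < b" "c > 0" "\<epsilon> > 0"
  defines "J \<equiv> integral {a..b} (\<lambda>t. 1 / (\<epsilon> + c * (t - y)\<^sup>2))"
  shows "J \<le> pi / sqrt (c * \<epsilon>)"
    and "pi / sqrt (c * \<epsilon>) - J \<le> (1 / (b - y) + 1 / (y - a)) / c"
proof -
  define r where "r = sqrt (c / \<epsilon>)"
  have r: "r > 0" "r\<^sup>2 = c / \<epsilon>" using assms by (auto simp: r_def)
  have re: "sqrt (c * \<epsilon>) = r * \<epsilon>"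
    using assms by (simp add: r_def real_sqrt_divide real_sqrt_mult field_simps)
  have cr: "c = r * r * \<epsilon>" using r(2) assms by (simp add: power2_eq_square field_simps)
  have "arctan (r * (a - y)) = - arctan (r * (y - a))"
    by (metis arctan_minus minus_diff_eq mult_minus_right)
  then have J: "J = (arctan (r * (b - y)) + arctan (r * (y - a))) / (r * \<epsilon>)"
    using reciprocal_quadratic_integral[of a b c \<epsilon> y] assms unfolding J_def re r_def[symmetric]
    by (simp add: integral_unique)
  show "J \<le> pi / sqrt (c * \<epsilon>)"
    unfolding J re using arctan_ubound[of "r * (b - y)"] arctan_ubound[of "r * (y - a)"] r assms
    by (intro divide_right_mono) auto
  have "pi / sqrt (c * \<epsilon>) - J = ((pi/2 - arctan (r * (b - y))) + (pi/2 - arctan (r * (y - a)))) / (r * \<epsilon>)"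
    unfolding J re by (simp add: diff_divide_distrib add_divide_distrib)
  also have "\<dots> \<le> (1 / (r * (b - y)) + 1 / (r * (y - a))) / (r * \<epsilon>)"
    using r assms by (intro divide_right_mono add_mono arctan_defect) auto
  also have "\<dots> = (1 / (b - y) + 1 / (y - a)) / c"
    unfolding cr by (simp add: add_divide_distrib mult_ac)
  finally show "pi / sqrt (c * \<epsilon>) - J \<le> (1 / (b - y) + 1 / (y - a)) / c" .
qed

section \<open>Pointwise comparison with the Lorentzian models\<close>

text \<open>Near a quadratic zero \<open>x\<close> of \<open>F\<close>, with \<open>s = \<bar>t - x\<bar>\<close>, both denominators are at least a constant
  times \<open>\<epsilon> + s\<^sup>2\<close>, while they differ by \<open>O(s\<^sup>3 + \<epsilon> * s\<^sup>2)\<close> and the numerators by \<open>O(s)\<close>. Hence the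
  quotients differ by \<open>O(1 + s / (\<epsilon> + s\<^sup>2))\<close>, one power of \<open>s\<close> better
  than the size of each of them, up to a bounded term.\<close>

lemma local_model_comparison:
  fixes \<phi> :: "real \<Rightarrow> complex" and F :: "real \<Rightarrow> real"
  assumes c: "c > 0" and d: "d > 0"
    and F: "\<And>t. \<bar>t - x\<bar> < d \<Longrightarrow> \<bar>F t - c * (t - x)\<^sup>2\<bar> \<le> K * \<bar>t - x\<bar> ^ 3"
    and \<phi>: "\<And>t. cmod (\<phi> t - \<phi> x) \<le> L * \<bar>t - x\<bar>"
  shows "\<exists>\<delta>>0. \<exists>C\<ge>0. \<forall>\<epsilon> t. 0 < \<epsilon> \<longrightarrow> \<epsilon> < 1/2 \<longrightarrow> \<bar>t - x\<bar> < \<delta> \<longrightarrow>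
    cmod (\<phi> t / of_real (\<epsilon> + (1 - \<epsilon>) * F t) - \<phi> x / of_real (\<epsilon> + c * (t - x)\<^sup>2))
      \<le> C * (1 + \<bar>t - x\<bar> / (\<epsilon> + (t - x)\<^sup>2))"
proof -
  define K' where "K' = max K 1"
  define L' where "L' = max L 0"
  have K': "K' \<ge> 1" "K \<le> K'" and L': "L' \<ge> 0" "L \<le> L'" by (auto simp: K'_def L'_def)
  \<comment> \<open>Within this radius the cubic error is at most half of \<open>c * (t - x)\<^sup>2\<close>, so \<open>F\<close> lies between \<open>1/2\<close> and \<open>3/2\<close> of its model.\<close>
  define \<delta> where "\<delta> = min d (c / (2 * K'))"
  define b where "b = min 1 (c / 4)"
  define C where "C = L' / b + cmod (\<phi> x) * (K' + 3/2 * c) / b\<^sup>2"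
  have b: "b > 0" "b \<le> 1" "b \<le> c / 4" using c by (auto simp: b_def)
  have \<delta>: "\<delta> > 0" using c d K' by (auto simp: \<delta>_def)
  have C: "C \<ge> 0" using b c K' L' by (auto simp: C_def)
  have main: "cmod (\<phi> t / of_real (\<epsilon> + (1 - \<epsilon>) * F t) - \<phi> x / of_real (\<epsilon> + c * (t - x)\<^sup>2))
      \<le> C * (1 + \<bar>t - x\<bar> / (\<epsilon> + (t - x)\<^sup>2))"
    if e: "0 < \<epsilon>" "\<epsilon> < 1/2" and t: "\<bar>t - x\<bar> < \<delta>" for \<epsilon> t
  proof -
    define s where "s = \<bar>t - x\<bar>"
    define D where "D = \<epsilon> + (1 - \<epsilon>) * F t"
    define M where "M = \<epsilon> + c * s\<^sup>2"
    define Q where "Q = \<epsilon> + s\<^sup>2"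
    have s: "s \<ge> 0" "s < d" "K' * s \<le> c / 2" 
      using t K' by (auto simp: s_def \<delta>_def field_simps)
    have sq: "(t - x)\<^sup>2 = s\<^sup>2" by (simp add: s_def)
    have Q: "Q > 0" "\<epsilon> \<le> Q" "s\<^sup>2 \<le> Q" using e by (auto simp: Q_def add_pos_nonneg)
    have cube: "K' * s ^ 3 = (K' * s) * s\<^sup>2" by (simp add: power_def eval_nat_numeral)
    have "K' * s ^ 3 \<le> c / 2 * s\<^sup>2" unfolding cube using s by (intro mult_right_mono) auto
    moreover have F1: "\<bar>F t - c * s\<^sup>2\<bar> \<le> K' * s ^ 3"
      using F[of t] s K' mult_right_mono[of K K' "s^3"] unfolding sq s_def[symmetric] by auto
    ultimately have F2: "F t \<ge> c / 2 * s\<^sup>2" "F t \<le> 3/2 * c * s\<^sup>2" by (auto simp: abs_le_iff)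
    have F0: "F t \<ge> 0" using F2(1) c by (meson divide_nonneg_nonneg less_eq_real_def mult_nonneg_nonneg order_trans zero_le_numeral zero_le_power2)
    have "D \<ge> \<epsilon> + 1/2 * (c / 2 * s\<^sup>2)"
      unfolding D_def using e F2 F0 c by (intro add_left_mono mult_mono) auto
    moreover have "b * Q \<le> \<epsilon> + c / 4 * s\<^sup>2"
      unfolding Q_def distrib_left using b e mult_right_mono[of b 1 \<epsilon>] by (intro add_mono mult_right_mono) auto
    note bQ4 = this
    ultimately have DQ: "D \<ge> b * Q" by simp
    have "c / 4 * s\<^sup>2 \<le> c * s\<^sup>2" using c by (intro mult_right_mono) auto
    with bQ4 have MQ: "M \<ge> b * Q" by (simp add: M_def)
    have bQ: "b * Q > 0" using b Q by simp
    have pos: "D > 0" "M > 0" using DQ MQ bQ by linarith+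
    have eF: "\<epsilon> * F t \<le> \<epsilon> * (3/2 * c * s\<^sup>2)" using e F2 by (intro mult_left_mono) auto
    have "\<bar>M - D\<bar> \<le> \<bar>F t - c * s\<^sup>2\<bar> + \<epsilon> * F t"
    proof -
      have "M - D = (c * s\<^sup>2 - F t) + \<epsilon> * F t" by (simp add: M_def D_def algebra_simps)
      moreover have "\<epsilon> * F t \<ge> 0" using e F0 by simp
      ultimately show ?thesis by linarith
    qed
    also have "\<dots> \<le> K' * s ^ 3 + \<epsilon> * (3/2 * c * s\<^sup>2)" using F1 eF by linarith
    also have "\<dots> = K' * s * s\<^sup>2 + 3/2 * c * (\<epsilon> * s\<^sup>2)" by (simp add: cube)
    also have "\<dots> \<le> K' * s * Q + 3/2 * c * (Q * Q)"
      using K' s Q e c by (intro add_mono mult_mono mult_left_mono) auto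
    finally have MD: "\<bar>M - D\<bar> \<le> K' * s * Q + 3/2 * c * (Q * Q)" .
    have "cmod (1 / of_real D - 1 / of_real M) = \<bar>M - D\<bar> / (D * M)"
    proof -
      have "1 / complex_of_real D - 1 / of_real M = of_real ((M - D) / (D * M))"
        using pos by (simp add: field_simps)
      then show ?thesis using pos by (simp only: norm_of_real) (simp add: abs_mult)
    qed
    also have "\<dots> \<le> (K' * s * Q + 3/2 * c * (Q * Q)) / ((b * Q) * (b * Q))"
      using MD DQ MQ bQ by (intro frac_le mult_mono) auto
    also have "\<dots> = (K' * (s / Q) + 3/2 * c) / b\<^sup>2"
      using Q b by (simp add: field_simps power2_eq_square)
    also have "\<dots> \<le> ((K' + 3/2 * c) * (1 + s / Q)) / b\<^sup>2"
    proof (intro divide_right_mono)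
      have aux: "k * v + w \<le> (k + w) * (1 + v)" if "0 \<le> k" "0 \<le> v" "0 \<le> w" for k v w :: real
        using that by (simp add: algebra_simps)
      show "K' * (s / Q) + 3/2 * c \<le> (K' + 3/2 * c) * (1 + s / Q)" using K' s Q c by (intro aux) auto
    qed auto
    finally have diff: "cmod (1 / of_real D - 1 / of_real M) \<le> (K' + 3/2 * c) * (1 + s / Q) / b\<^sup>2" .
    have Lip: "cmod (\<phi> t - \<phi> x) \<le> L' * s" using \<phi>[of t] L' mult_right_mono[of L L' s] s(1) unfolding s_def by linarith
    have "cmod ((\<phi> t - \<phi> x) / of_real D) \<le> L' * s / (b * Q)"
      unfolding norm_divide norm_of_real using pos Lip DQ bQ L' s by (intro frac_le) auto
    also have "\<dots> = L' / b * (s / Q)" by simp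
    also have "\<dots> \<le> L' / b * (1 + s / Q)" using L' b by (intro mult_left_mono) auto
    finally have first: "cmod ((\<phi> t - \<phi> x) / of_real D) \<le> L' / b * (1 + s / Q)" .
    have "\<phi> t / of_real D - \<phi> x / of_real M = (\<phi> t - \<phi> x) / of_real D + \<phi> x * (1 / of_real D - 1 / of_real M)"
      by (simp add: algebra_simps diff_divide_distrib)
    then have "cmod (\<phi> t / of_real D - \<phi> x / of_real M) 
        \<le> cmod ((\<phi> t - \<phi> x) / of_real D) + cmod (\<phi> x) * cmod (1 / of_real D - 1 / of_real M)"
      by (metis norm_mult norm_triangle_ineq)
    also have "\<dots> \<le> L' / b * (1 + s / Q) + cmod (\<phi> x) * ((K' + 3/2 * c) * (1 + s / Q) / b\<^sup>2)"
      by (intro add_mono first mult_left_mono diff) auto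
    also have "\<dots> = C * (1 + s / Q)" unfolding C_def by (simp add: algebra_simps add_divide_distrib)
    finally show ?thesis unfolding D_def M_def Q_def sq s_def[symmetric] .
  qed
  show ?thesis using \<delta> C main by blast
qed

lemma quotient_bounded_near_nonzero:
  fixes \<phi> :: "real \<Rightarrow> complex" and F :: "real \<Rightarrow> real"
  assumes F: "continuous (at x within S) F" "F x > 0"
    and \<phi>: "\<And>t. cmod (\<phi> t - \<phi> x) \<le> L * \<bar>t - x\<bar>"
  shows "\<exists>\<delta>>0. \<exists>C\<ge>0. \<forall>\<epsilon> t. 0 < \<epsilon> \<longrightarrow> \<epsilon> < 1/2 \<longrightarrow> t \<in> S \<longrightarrow> \<bar>t - x\<bar> < \<delta> \<longrightarrow>
    cmod (\<phi> t / of_real (\<epsilon> + (1 - \<epsilon>) * F t)) \<le> C"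
proof -
  from F obtain d where d: "d > 0" "\<And>t. t \<in> S \<Longrightarrow> \<bar>t - x\<bar> < d \<Longrightarrow> \<bar>F t - F x\<bar> < F x / 2"
    unfolding continuous_within_eps_delta dist_real_def by (metis half_gt_zero)
  define \<delta> where "\<delta> = min d 1"
  define C where "C = (cmod (\<phi> x) + \<bar>L\<bar>) / (F x / 4)"
  have "cmod (\<phi> t / of_real (\<epsilon> + (1 - \<epsilon>) * F t)) \<le> C"
    if e: "0 < \<epsilon>" "\<epsilon> < 1/2" and t: "t \<in> S" "\<bar>t - x\<bar> < \<delta>" for \<epsilon> t
  proof -
    have "\<bar>F t - F x\<bar> < F x / 2" using d(2)[of t] t by (simp add: \<delta>_def)
    then have "F t \<ge> F x / 2" by linarith
    then have "(1 - \<epsilon>) * F t \<ge> 1/2 * (F x / 2)" using e F by (intro mult_mono) auto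
    then have D: "\<epsilon> + (1 - \<epsilon>) * F t \<ge> F x / 4" using e by simp
    have "L * \<bar>t - x\<bar> \<le> \<bar>L\<bar> * 1" using t by (intro mult_mono) (auto simp: \<delta>_def)
    then have "cmod (\<phi> t) \<le> cmod (\<phi> x) + \<bar>L\<bar>"
      using \<phi>[of t] norm_triangle_sub[of "\<phi> t" "\<phi> x"] by linarith
    then show ?thesis
      unfolding norm_divide norm_of_real C_def using D F(2) by (intro frac_le) auto
  qed
  moreover have "\<delta> > 0" "C \<ge> 0" using d F by (auto simp: \<delta>_def C_def)
  ultimately show ?thesis by blast
qed

lemma model_bounded_away_from_centre:
  fixes x y c :: real and z :: complex
  assumes "x \<noteq> y" "c > 0"
  shows "\<exists>\<delta>>0. \<exists>C\<ge>0. \<forall>\<epsilon> t. 0 < \<epsilon> \<longrightarrow> \<bar>t - x\<bar> < \<delta> \<longrightarrow> cmod (z / of_real (\<epsilon> + c * (t - y)\<^sup>2)) \<le> C"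
proof -
  define \<delta> where "\<delta> = \<bar>x - y\<bar> / 2"
  have \<delta>: "\<delta> > 0" using assms by (simp add: \<delta>_def)
  have "cmod (z / of_real (\<epsilon> + c * (t - y)\<^sup>2)) \<le> cmod z / (c * \<delta>\<^sup>2)"
    if "0 < \<epsilon>" "\<bar>t - x\<bar> < \<delta>" for \<epsilon> t
  proof -
    have "\<bar>\<delta>\<bar> \<le> \<bar>t - y\<bar>" using that by (auto simp: \<delta>_def abs_if split: if_splits)
    then have "\<delta>\<^sup>2 \<le> (t - y)\<^sup>2" by (simp add: abs_le_square_iff)
    then have "c * \<delta>\<^sup>2 \<le> \<epsilon> + c * (t - y)\<^sup>2" using assms that
      by (smt (verit) mult_left_mono)
    then show ?thesis unfolding norm_divide norm_of_real using assms \<delta> by (intro frac_le) auto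
  qed
  moreover have "0 \<le> cmod z / (c * \<delta>\<^sup>2)" using assms by simp
  ultimately show ?thesis using \<delta> by blast
qed

text \<open>The real-variable situation to which the theorem reduces: a nonnegative \<open>F\<close> on \<open>[a, b]\<close> whose
  zeros are finitely many interior points with a nondegenerate quadratic expansion and cubic error.
  Keeping the zeros away from \<open>a\<close> and \<open>b\<close> means that each contributes a whole Lorentzian rather
  than a half.\<close>

locale quadratic_minima =
  fixes \<phi> :: "real \<Rightarrow> complex" and F :: "real \<Rightarrow> real" and a b L :: real
    and T :: "real set" and c :: "real \<Rightarrow> real"
  assumes ab: "a < b" and T: "finite T" "T \<subseteq> {a<..<b}"
    and F_cont: "continuous_on {a..b} F"
    and F_nonneg: "\<And>t. t \<in> {a..b} \<Longrightarrow> F t \<ge> 0"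
    and F_pos: "\<And>t. t \<in> {a..b} \<Longrightarrow> t \<notin> T \<Longrightarrow> F t > 0"
    and c_pos: "\<And>x. x \<in> T \<Longrightarrow> c x > 0"
    and F_quadratic: "\<And>x. x \<in> T \<Longrightarrow> \<exists>d>0. \<exists>K. \<forall>t. \<bar>t - x\<bar> < d \<longrightarrow> \<bar>F t - c x * (t - x)\<^sup>2\<bar> \<le> K * \<bar>t - x\<bar> ^ 3"
    and \<phi>_Lipschitz: "\<And>s t. cmod (\<phi> t - \<phi> s) \<le> L * \<bar>t - s\<bar>"
begin

definition remainder :: "real \<Rightarrow> real \<Rightarrow> complex" where
  "remainder \<epsilon> t = \<phi> t / of_real (\<epsilon> + (1 - \<epsilon>) * F t) - (\<Sum>y\<in>T. \<phi> y / of_real (\<epsilon> + c y * (t - y)\<^sup>2))"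

definition majorant :: "real \<Rightarrow> real \<Rightarrow> real" where
  "majorant \<epsilon> t = 1 + (\<Sum>y\<in>T. \<bar>t - y\<bar> / (\<epsilon> + (t - y)\<^sup>2))"

lemma majorant_ge: 
  assumes "\<epsilon> > 0"
  shows "majorant \<epsilon> t \<ge> 1" "y \<in> T \<Longrightarrow> majorant \<epsilon> t \<ge> 1 + \<bar>t - y\<bar> / (\<epsilon> + (t - y)\<^sup>2)"
proof -
  have nn: "\<bar>t - y\<bar> / (\<epsilon> + (t - y)\<^sup>2) \<ge> 0" for y using assms by simp
  show "majorant \<epsilon> t \<ge> 1" unfolding majorant_def using nn by (simp add: sum_nonneg)
  show "y \<in> T \<Longrightarrow> majorant \<epsilon> t \<ge> 1 + \<bar>t - y\<bar> / (\<epsilon> + (t - y)\<^sup>2)"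
    unfolding majorant_def using nn T member_le_sum[of y T "\<lambda>y. \<bar>t - y\<bar> / (\<epsilon> + (t - y)\<^sup>2)"] by simp
qed

text \<open>Around any \<open>x\<close> at most one summand of the model sum is large, namely the one centred at \<open>x\<close>, and
  that one is matched by the singularity of \<open>\<phi> / (\<epsilon> + (1 - \<epsilon>) * F)\<close>; everything else is bounded
  uniformly in \<open>\<epsilon>\<close>.\<close>

lemma remainder_le_majorant_locally:
  assumes x: "x \<in> {a..b}"
  shows "\<exists>\<delta>>0. \<exists>C\<ge>0. \<forall>\<epsilon> t. 0 < \<epsilon> \<longrightarrow> \<epsilon> < 1/2 \<longrightarrow> t \<in> {a..b} \<longrightarrow> \<bar>t - x\<bar> < \<delta> \<longrightarrow>
    cmod (remainder \<epsilon> t) \<le> C * majorant \<epsilon> t"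
proof -
  \<comment> \<open>The part of the remainder that may be singular at \<open>x\<close>.\<close>
  define A where "A \<epsilon> t = \<phi> t / of_real (\<epsilon> + (1 - \<epsilon>) * F t)
     - (if x \<in> T then \<phi> x / of_real (\<epsilon> + c x * (t - x)\<^sup>2) else 0)" for \<epsilon> t
  have "\<exists>\<delta>>0. \<exists>C\<ge>0. \<forall>\<epsilon> t. 0 < \<epsilon> \<longrightarrow> \<epsilon> < 1/2 \<longrightarrow> t \<in> {a..b} \<longrightarrow> \<bar>t - x\<bar> < \<delta> \<longrightarrow>
    cmod (A \<epsilon> t) \<le> C * majorant \<epsilon> t"
  proof (cases "x \<in> T")
    case True
    from F_quadratic[OF True] obtain d K where "d > 0"
      "\<And>t. \<bar>t - x\<bar> < d \<Longrightarrow> \<bar>F t - c x * (t - x)\<^sup>2\<bar> \<le> K * \<bar>t - x\<bar> ^ 3" by blast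
    from local_model_comparison[OF c_pos[OF True] this \<phi>_Lipschitz]
    obtain \<delta> C where *: "\<delta> > 0" "C \<ge> 0" "\<And>\<epsilon> t. 0 < \<epsilon> \<Longrightarrow> \<epsilon> < 1/2 \<Longrightarrow> \<bar>t - x\<bar> < \<delta> \<Longrightarrow>
       cmod (\<phi> t / of_real (\<epsilon> + (1 - \<epsilon>) * F t) - \<phi> x / of_real (\<epsilon> + c x * (t - x)\<^sup>2))
         \<le> C * (1 + \<bar>t - x\<bar> / (\<epsilon> + (t - x)\<^sup>2))" by blast
    have "cmod (A \<epsilon> t) \<le> C * majorant \<epsilon> t" if "0 < \<epsilon>" "\<epsilon> < 1/2" "\<bar>t - x\<bar> < \<delta>" for \<epsilon> t
      using *(3)[OF that] mult_left_mono[OF majorant_ge(2)[OF that(1) True] *(2)] True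
      unfolding A_def by (simp only: if_True) (meson order_trans)
    with * show ?thesis by blast
  next
    case False
    have "continuous (at x within {a..b}) F" using F_cont x by (simp add: continuous_on_eq_continuous_within)
    from quotient_bounded_near_nonzero[OF this F_pos[OF x False] \<phi>_Lipschitz]
    obtain \<delta> C where *: "\<delta> > 0" "C \<ge> 0" "\<And>\<epsilon> t. 0 < \<epsilon> \<Longrightarrow> \<epsilon> < 1/2 \<Longrightarrow> t \<in> {a..b} \<Longrightarrow> \<bar>t - x\<bar> < \<delta> \<Longrightarrow>
      cmod (\<phi> t / of_real (\<epsilon> + (1 - \<epsilon>) * F t)) \<le> C" by blast
    have "cmod (A \<epsilon> t) \<le> C * majorant \<epsilon> t" if "0 < \<epsilon>" "\<epsilon> < 1/2" "t \<in> {a..b}" "\<bar>t - x\<bar> < \<delta>" for \<epsilon> t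
      using *(3)[OF that] mult_left_mono[OF majorant_ge(1)[OF that(1)] *(2)] False
      unfolding A_def by (simp only: if_False diff_0_right mult_1_right) (meson order_trans)
    with * show ?thesis by blast
  qed
  then obtain \<delta>0 C0 where A: "\<delta>0 > 0" "C0 \<ge> 0" "\<And>\<epsilon> t. 0 < \<epsilon> \<Longrightarrow> \<epsilon> < 1/2 \<Longrightarrow> t \<in> {a..b} \<Longrightarrow> \<bar>t - x\<bar> < \<delta>0 \<Longrightarrow>
    cmod (A \<epsilon> t) \<le> C0 * majorant \<epsilon> t" by blast
  define P where "P y \<delta> C \<longleftrightarrow> \<delta> > 0 \<and> C \<ge> 0 \<and> (\<forall>\<epsilon> t. 0 < \<epsilon> \<longrightarrow> \<bar>t - x\<bar> < \<delta> \<longrightarrow> 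
     cmod (\<phi> y / of_real (\<epsilon> + c y * (t - y)\<^sup>2)) \<le> C)" for y \<delta> C
  have "\<forall>y\<in>T - {x}. \<exists>\<delta> C. P y \<delta> C" 
    unfolding P_def using model_bounded_away_from_centre c_pos by (metis DiffE insertI1)
  then obtain \<delta> C where P: "\<And>y. y \<in> T - {x} \<Longrightarrow> P y (\<delta> y) (C y)" by metis
  define r where "r = Min (insert \<delta>0 (\<delta> ` (T - {x})))"
  define K where "K = C0 + (\<Sum>y\<in>T - {x}. C y)"
  have r: "r > 0" "r \<le> \<delta>0" "\<And>y. y \<in> T - {x} \<Longrightarrow> r \<le> \<delta> y"
    using A(1) P T(1) by (auto simp: r_def P_def)
  have Csum: "(\<Sum>y\<in>T - {x}. C y) \<ge> 0" using P by (intro sum_nonneg) (auto simp: P_def)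
  have "cmod (remainder \<epsilon> t) \<le> K * majorant \<epsilon> t"
    if e: "0 < \<epsilon>" "\<epsilon> < 1/2" and t: "t \<in> {a..b}" "\<bar>t - x\<bar> < r" for \<epsilon> t
  proof -
    let ?m = "\<lambda>y. \<phi> y / of_real (\<epsilon> + c y * (t - y)\<^sup>2)"
    have split: "(\<Sum>y\<in>T. ?m y) = (if x \<in> T then ?m x else 0) + (\<Sum>y\<in>T - {x}. ?m y)"
      using T(1) by (auto simp: sum.remove)
    have "remainder \<epsilon> t = A \<epsilon> t - (\<Sum>y\<in>T - {x}. ?m y)"
      unfolding remainder_def A_def split by simp
    also have "cmod \<dots> \<le> cmod (A \<epsilon> t) + (\<Sum>y\<in>T - {x}. cmod (?m y))"
      by (intro order_trans[OF norm_triangle_ineq4] add_left_mono norm_sum)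
    also have "\<dots> \<le> C0 * majorant \<epsilon> t + (\<Sum>y\<in>T - {x}. C y)"
    proof (intro add_mono sum_mono)
      show "cmod (A \<epsilon> t) \<le> C0 * majorant \<epsilon> t" using A(3) e t r(2) by simp
      fix y assume y: "y \<in> T - {x}"
      show "cmod (?m y) \<le> C y" using P[OF y] r(3)[OF y] e t unfolding P_def by force
    qed
    also have "\<dots> \<le> K * majorant \<epsilon> t"
      using mult_left_mono[OF majorant_ge(1)[OF e(1), of t] Csum] by (simp add: K_def algebra_simps)
    finally show ?thesis .
  qed
  moreover have "K \<ge> 0" using A(2) Csum by (simp add: K_def)
  ultimately show ?thesis using r(1) by blast
qed

lemma remainder_le_majorant:
  "\<exists>C\<ge>0. \<forall>\<epsilon> t. 0 < \<epsilon> \<longrightarrow> \<epsilon> < 1/2 \<longrightarrow> t \<in> {a..b} \<longrightarrow> cmod (remainder \<epsilon> t) \<le> C * majorant \<epsilon> t"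
proof -
  obtain \<delta> C where *: "\<And>x. x \<in> {a..b} \<Longrightarrow> \<delta> x > 0 \<and> C x \<ge> 0 \<and> (\<forall>\<epsilon> t. 0 < \<epsilon> \<longrightarrow> \<epsilon> < 1/2 \<longrightarrow> t \<in> {a..b} \<longrightarrow> \<bar>t - x\<bar> < \<delta> x \<longrightarrow>
    cmod (remainder \<epsilon> t) \<le> C x * majorant \<epsilon> t)"
    using remainder_le_majorant_locally by metis
  have "{a..b} \<subseteq> (\<Union>x\<in>{a..b}. ball x (\<delta> x))" using * by force
  then obtain X where X: "X \<subseteq> {a..b}" "finite X" "{a..b} \<subseteq> (\<Union>x\<in>X. ball x (\<delta> x))"
    by (rule compactE_image[OF compact_Icc, rotated]) auto
  define K where "K = (\<Sum>x\<in>X. C x)"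
  have Cx: "C x \<ge> 0" if "x \<in> X" for x using * X(1) that by blast
  have CK: "C x \<le> K" if "x \<in> X" for x
    unfolding K_def using that X(2) Cx by (intro member_le_sum) auto
  have "cmod (remainder \<epsilon> t) \<le> K * majorant \<epsilon> t" if e: "0 < \<epsilon>" "\<epsilon> < 1/2" and t: "t \<in> {a..b}" for \<epsilon> t
  proof -
    from t X(3) obtain x where x: "x \<in> X" "\<bar>t - x\<bar> < \<delta> x" by (force simp: dist_real_def)
    then have "cmod (remainder \<epsilon> t) \<le> C x * majorant \<epsilon> t" using * X(1) e t by blast
    also have "\<dots> \<le> K * majorant \<epsilon> t" using CK[OF x(1)] majorant_ge(1)[OF e(1), of t] by (intro mult_right_mono) auto
    finally show ?thesis .
  qed
  moreover have "K \<ge> 0" using Cx by (simp add: K_def sum_nonneg)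
  ultimately show ?thesis by blast
qed

text \<open>By the weighted inequality \<open>s \<le> q + s\<^sup>2 / q\<close> the majorant is itself dominated by Lorentzians, whose
  integral is known. With \<open>q\<close> the fourth root of \<open>\<epsilon>\<close> both terms integrate to \<open>O(1 / q)\<close>, which is
  the error exponent of the theorem; the sharper logarithmic bound is thereby avoided.\<close>

lemma majorant_le:
  assumes "\<epsilon> > 0" "q > 0"
  shows "majorant \<epsilon> t \<le> 1 + (\<Sum>y\<in>T. q * (1 / (\<epsilon> + 1 * (t - y)\<^sup>2)) + 1 / q)"
  unfolding majorant_def
proof (intro add_left_mono sum_mono)
  fix y
  define s where "s = \<bar>t - y\<bar>"
  have sq: "(t - y)\<^sup>2 = s\<^sup>2" and s: "s \<ge> 0" by (auto simp: s_def)
  have Q: "\<epsilon> + s\<^sup>2 > 0" using assms by (simp add: add_pos_nonneg)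
  have "s \<le> q + s\<^sup>2 / q"
  proof -
    have "0 \<le> (s - q)\<^sup>2" and "0 \<le> q * s" using assms s by auto
    moreover have "(s - q)\<^sup>2 = s\<^sup>2 - 2 * (q * s) + q * q"
      by (simp add: power2_eq_square algebra_simps)
    ultimately have "q * s \<le> q * q + s\<^sup>2" by linarith
    then show ?thesis using assms by (simp add: field_simps power2_eq_square)
  qed
  also have "\<dots> \<le> q + (\<epsilon> + s\<^sup>2) / q" using assms by (simp add: divide_right_mono)
  finally have "s / (\<epsilon> + s\<^sup>2) \<le> (q + (\<epsilon> + s\<^sup>2) / q) / (\<epsilon> + s\<^sup>2)" using Q by (intro divide_right_mono) auto
  also have "\<dots> = q * (1 / (\<epsilon> + s\<^sup>2)) + 1 / q"
  proof -
    have "(q + R / q) / R = q * (1 / R) + 1 / q" if "R > 0" for R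
      using that by (simp add: add_divide_distrib)
    then show ?thesis using Q by blast
  qed
  finally show "\<bar>t - y\<bar> / (\<epsilon> + (t - y)\<^sup>2) \<le> q * (1 / (\<epsilon> + 1 * (t - y)\<^sup>2)) + 1 / q"
    unfolding sq s_def[symmetric] by simp
qed

text \<open>The model sum integrates to the main term up to \<open>O(1)\<close>, and the remainder to
  \<open>O(\<epsilon> powr (-1/4))\<close> because its majorant does.\<close>

lemma asymptotics:
  "(\<lambda>\<epsilon>. integral {a..b} (\<lambda>t. \<phi> t / of_real (\<epsilon> + (1 - \<epsilon>) * F t))
     - of_real (1 / sqrt \<epsilon>) * (\<Sum>y\<in>T. of_real pi * \<phi> y / of_real (sqrt (c y))))
   \<in> O[at_right 0](\<lambda>\<epsilon>. complex_of_real (1 / \<epsilon> powr (1/4)))"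
proof -
  obtain C where C: "C \<ge> 0" "\<And>\<epsilon> t. 0 < \<epsilon> \<Longrightarrow> \<epsilon> < 1/2 \<Longrightarrow> t \<in> {a..b} \<Longrightarrow> cmod (remainder \<epsilon> t) \<le> C * majorant \<epsilon> t"
    using remainder_le_majorant by blast
  define B where "B = (\<Sum>y\<in>T. cmod (\<phi> y) * ((1 / (b - y) + 1 / (y - a)) / c y))"
  define N where "N = real (card T)"
  define K where "K = C * ((b - a) * (1 + N) + N * pi) + B"
  have Ty: "a < y" "y < b" if "y \<in> T" for y using T(2) that by auto
  have B0: "B \<ge> 0" unfolding B_def
    using Ty c_pos by (intro sum_nonneg mult_nonneg_nonneg divide_nonneg_pos add_nonneg_nonneg) auto
  have main: "cmod (integral {a..b} (\<lambda>t. \<phi> t / of_real (\<epsilon> + (1 - \<epsilon>) * F t))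
     - of_real (1 / sqrt \<epsilon>) * (\<Sum>y\<in>T. of_real pi * \<phi> y / of_real (sqrt (c y)))) \<le> K * (1 / \<epsilon> powr (1/4))"
    if e: "0 < \<epsilon>" "\<epsilon> < 1/2" for \<epsilon>
  proof -
    define q where "q = \<epsilon> powr (1/4)"
    have q: "q > 0" "q \<le> 1" using e powr_mono2[of "1/4" \<epsilon> 1] by (auto simp: q_def)
    have qq: "sqrt \<epsilon> = q * q" 
      using e by (simp add: q_def powr_half_sqrt[symmetric] flip: powr_add)
    define J where "J y = integral {a..b} (\<lambda>t. 1 / (\<epsilon> + c y * (t - y)\<^sup>2))" for y
    define I where "I y = integral {a..b} (\<lambda>t. 1 / (\<epsilon> + 1 * (t - y)\<^sup>2))" for y
    define m where "m t = 1 + (\<Sum>y\<in>T. q * (1 / (\<epsilon> + 1 * (t - y)\<^sup>2)) + 1 / q)" for t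
    have m_int: "(m has_integral (b - a) + (\<Sum>y\<in>T. q * I y + (b - a) * (1 / q))) {a..b}"
    proof -
      have I: "((\<lambda>t. 1 / (\<epsilon> + 1 * (t - y)\<^sup>2)) has_integral I y) {a..b}" for y
        unfolding I_def using ab e
        by (intro integrable_integral[OF has_integral_integrable[OF reciprocal_quadratic_integral]]) auto
      have const: "((\<lambda>t. r) has_integral (b - a) * r) {a..b}" for r :: real
        using has_integral_const_real[of r a b] ab by simp
      have "((\<lambda>t. q * (1 / (\<epsilon> + 1 * (t - y)\<^sup>2)) + 1 / q) has_integral q * I y + (b - a) * (1 / q)) {a..b}" for y
        by (rule has_integral_add[OF has_integral_mult_right[OF I] const])
      from has_integral_add[OF const[of 1] has_integral_sum[OF T(1) this]]
      show ?thesis unfolding m_def by simp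
    qed
    have Ile: "q * I y \<le> pi / q" if "y \<in> T" for y
    proof -
      have "I y \<le> pi / (q * q)"
        using reciprocal_quadratic_integral_bounds(1)[of a y b 1 \<epsilon>] Ty[OF that] e
        unfolding I_def by (simp add: qq)
      then have "q * I y \<le> q * (pi / (q * q))" using q by (intro mult_left_mono) auto
      then show ?thesis using q by simp
    qed
    have D: "\<epsilon> + (1 - \<epsilon>) * F t \<noteq> 0" if "t \<in> {a..b}" for t
    proof -
      have "(1 - \<epsilon>) * F t \<ge> 0" using F_nonneg[OF that] e by simp
      then show ?thesis using e by linarith
    qed
    have \<phi>_cont: "continuous_on {a..b} \<phi>"
      by (rule lipschitz_on_continuous_on[where L = "\<bar>L\<bar>"])
        (auto simp: lipschitz_on_def dist_norm intro!: order_trans[OF \<phi>_Lipschitz] mult_right_mono)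
    have main_int: "(\<lambda>t. \<phi> t / of_real (\<epsilon> + (1 - \<epsilon>) * F t)) integrable_on {a..b}"
      using D by (intro integrable_continuous_real continuous_intros \<phi>_cont F_cont) (simp del: of_real_add of_real_mult of_real_diff)
    have model_int: "((\<lambda>t. \<phi> y / of_real (\<epsilon> + c y * (t - y)\<^sup>2)) has_integral \<phi> y * of_real (J y)) {a..b}" if "y \<in> T" for y
    proof -
      have "((\<lambda>t. 1 / (\<epsilon> + c y * (t - y)\<^sup>2)) has_integral J y) {a..b}"
        unfolding J_def using ab e c_pos[OF that]
        by (intro integrable_integral[OF has_integral_integrable[OF reciprocal_quadratic_integral]]) auto
      then have "((\<lambda>t. complex_of_real (1 / (\<epsilon> + c y * (t - y)\<^sup>2))) has_integral of_real (J y)) {a..b}"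
        by (rule has_integral_of_real)
      then have "((\<lambda>t. \<phi> y * complex_of_real (1 / (\<epsilon> + c y * (t - y)\<^sup>2))) has_integral \<phi> y * of_real (J y)) {a..b}"
        by (rule has_integral_mult_right)
      then show ?thesis by (simp add: of_real_divide)
    qed
    let ?I = "integral {a..b} (\<lambda>t. \<phi> t / of_real (\<epsilon> + (1 - \<epsilon>) * F t))"
    let ?S = "\<Sum>y\<in>T. \<phi> y * of_real (J y)"
    have rem_int: "(remainder \<epsilon> has_integral ?I - ?S) {a..b}"
      unfolding remainder_def
      by (rule has_integral_diff[OF integrable_integral[OF main_int] has_integral_sum[OF T(1) model_int]])
    have "cmod (integral {a..b} (remainder \<epsilon>)) \<le> integral {a..b} (\<lambda>t. C * m t)"
    proof (rule integral_norm_bound_integral)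
      show "remainder \<epsilon> integrable_on {a..b}" using rem_int by blast
      show "(\<lambda>t. C * m t) integrable_on {a..b}" using has_integral_mult_right[OF m_int] by blast
      show "cmod (remainder \<epsilon> t) \<le> C * m t" if "t \<in> {a..b}" for t
        using C(2)[OF e that] mult_left_mono[OF majorant_le[OF e(1) q(1), of t] C(1)] unfolding m_def by linarith
    qed
    also have "\<dots> = C * ((b - a) + (\<Sum>y\<in>T. q * I y + (b - a) * (1 / q)))"
      using has_integral_mult_right[OF m_int] by (rule integral_unique)
    also have "\<dots> \<le> C * ((b - a) * (1 / q) + (\<Sum>y\<in>T. pi / q + (b - a) * (1 / q)))"
    proof -
      have "(b - a) * 1 \<le> (b - a) * (1 / q)" using q ab by (intro mult_left_mono) auto
      then show ?thesis using Ile C(1) ab by (intro mult_left_mono add_mono sum_mono) auto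
    qed
    also have "\<dots> = C * ((b - a) * (1 + N) + N * pi) * (1 / q)"
      unfolding sum_constant N_def divide_inverse by (simp add: algebra_simps)
    finally have first: "cmod (?I - ?S) \<le> C * ((b - a) * (1 + N) + N * pi) * (1 / q)"
      using rem_int by (simp add: integral_unique)
    have "?S - of_real (1 / sqrt \<epsilon>) * (\<Sum>y\<in>T. of_real pi * \<phi> y / of_real (sqrt (c y)))
       = (\<Sum>y\<in>T. \<phi> y * of_real (J y - pi / sqrt (c y * \<epsilon>)))"
      unfolding sum_distrib_left sum_subtractf[symmetric]
      by (intro sum.cong refl) (simp add: real_sqrt_mult algebra_simps)
    also have "cmod \<dots> \<le> (\<Sum>y\<in>T. cmod (\<phi> y * of_real (J y - pi / sqrt (c y * \<epsilon>))))" by (rule norm_sum)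
    also have "\<dots> \<le> B" unfolding B_def
    proof (rule sum_mono)
      fix y assume y: "y \<in> T"
      have "\<bar>J y - pi / sqrt (c y * \<epsilon>)\<bar> \<le> (1 / (b - y) + 1 / (y - a)) / c y"
        using reciprocal_quadratic_integral_bounds[OF Ty[OF y] c_pos[OF y] e(1)] unfolding J_def by linarith
      then show "cmod (\<phi> y * of_real (J y - pi / sqrt (c y * \<epsilon>))) \<le> cmod (\<phi> y) * ((1 / (b - y) + 1 / (y - a)) / c y)"
        unfolding norm_mult norm_of_real by (intro mult_left_mono) auto
    qed
    also have "\<dots> \<le> B * (1 / q)" using B0 q mult_left_mono[of 1 "1 / q" B] by simp
    finally have second: "cmod (?S - of_real (1 / sqrt \<epsilon>) * (\<Sum>y\<in>T. of_real pi * \<phi> y / of_real (sqrt (c y)))) \<le> B * (1 / q)" .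
    let ?X = "of_real (1 / sqrt \<epsilon>) * (\<Sum>y\<in>T. of_real pi * \<phi> y / of_real (sqrt (c y)))"
    have "cmod (?I - ?X) \<le> cmod (?I - ?S) + cmod (?S - ?X)"
      using norm_triangle_ineq[of "?I - ?S" "?S - ?X"] by simp
    also have "\<dots> \<le> K * (1 / q)" using add_mono[OF first second] unfolding K_def distrib_right .
    finally show ?thesis unfolding q_def .
  qed
  have ev: "eventually (\<lambda>\<epsilon>::real. \<epsilon> \<in> {0<..<1/2}) (at_right 0)"
    by (rule eventually_at_right_real) simp
  show ?thesis
  proof (rule bigoI[of _ K], rule eventually_mono[OF ev])
    fix \<epsilon> :: real assume \<epsilon>: "\<epsilon> \<in> {0<..<1/2}"
    have "cmod (complex_of_real (1 / \<epsilon> powr (1/4))) = 1 / \<epsilon> powr (1/4)"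
      by (simp only: norm_of_real) simp
    then show "cmod (integral {a..b} (\<lambda>t. \<phi> t / of_real (\<epsilon> + (1 - \<epsilon>) * F t))
        - of_real (1 / sqrt \<epsilon>) * (\<Sum>y\<in>T. of_real pi * \<phi> y / of_real (sqrt (c y))))
      \<le> K * cmod (complex_of_real (1 / \<epsilon> powr (1/4)))"
      using main[of \<epsilon>] \<epsilon> by (simp only: greaterThanLessThan_iff)
  qed
qed

end

section \<open>The norm of a smooth curve at a maximum\<close>

text \<open>Repeated differentiation of \<open>g\<^sup>2 = f \<bullet> f\<close> determines each derivative of \<open>g\<close> after division by \<open>g\<close>, so
  away from the zeros of \<open>f\<close> the norm is as smooth as the curve.\<close>

lemma norm_curve_has_derivatives:
  fixes f f1 f2 f3 :: "real \<Rightarrow> 'a::real_inner"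
  assumes d1: "(f has_vector_derivative f1 t) (at t)"
    and d2: "(f1 has_vector_derivative f2 t) (at t)"
    and d3: "(f2 has_vector_derivative f3 t) (at t)"
    and nz: "f t \<noteq> 0"
  defines "g \<equiv> \<lambda>t. norm (f t)"
  defines "g1 \<equiv> \<lambda>t. (f t \<bullet> f1 t) / g t"
  defines "g2 \<equiv> \<lambda>t. (f1 t \<bullet> f1 t + f t \<bullet> f2 t - (g1 t)\<^sup>2) / g t"
  defines "g3 \<equiv> \<lambda>t. (3 * (f1 t \<bullet> f2 t) + f t \<bullet> f3 t - 3 * g1 t * g2 t) / g t"
  shows "(g has_real_derivative g1 t) (at t)"
    and "(g1 has_real_derivative g2 t) (at t)"
    and "(g2 has_real_derivative g3 t) (at t)"
proof -
  have inner: "((\<lambda>t. u t \<bullet> v t) has_real_derivative (u t \<bullet> v' + u' \<bullet> v t)) (at t)"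
    if "(u has_vector_derivative u') (at t)" "(v has_vector_derivative v') (at t)" for u v :: "real \<Rightarrow> 'a" and u' v'
    using bounded_bilinear.has_vector_derivative[OF bounded_bilinear_inner that]
    by (simp add: has_real_derivative_iff_has_vector_derivative)
  have gt: "g t > 0" using nz by (simp add: g_def)
  have "((\<lambda>t. sqrt (f t \<bullet> f t)) has_real_derivative inverse (sqrt (f t \<bullet> f t)) / 2 * (f t \<bullet> f1 t + f1 t \<bullet> f t)) (at t)"
    using nz by (intro DERIV_chain2[OF DERIV_real_sqrt inner[OF d1 d1]]) simp
  moreover have "(\<lambda>t. sqrt (f t \<bullet> f t)) = g" by (simp only: g_def norm_eq_sqrt_inner)
  moreover have "inverse (sqrt (f t \<bullet> f t)) / 2 * (f t \<bullet> f1 t + f1 t \<bullet> f t) = g1 t"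
  proof -
    have "inverse r / 2 * (b + b) = b / r" for r b :: real by (simp add: inverse_eq_divide)
    then show ?thesis
      unfolding g1_def g_def norm_eq_sqrt_inner inner_commute[of "f1 t" "f t"] .
  qed
  ultimately show D: "(g has_real_derivative g1 t) (at t)" by simp
  have "(g1 has_real_derivative ((f t \<bullet> f2 t + f1 t \<bullet> f1 t) * g t - (f t \<bullet> f1 t) * g1 t) / (g t * g t)) (at t)"
    unfolding g1_def using inner[OF d1 d2] D[unfolded g1_def] gt by (intro DERIV_divide) auto
  moreover have "((f t \<bullet> f2 t + f1 t \<bullet> f1 t) * g t - (f t \<bullet> f1 t) * g1 t) / (g t * g t) = g2 t"
  proof -
    have "f t \<bullet> f1 t = g1 t * g t" using gt by (simp add: g1_def)
    moreover have "(A * G - (b * G) * b) / (G * G) = (A - b\<^sup>2) / G" if "G > 0" for A b G :: real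
      using that by (simp add: field_simps power2_eq_square)
    ultimately show ?thesis using gt by (simp add: g2_def add.commute)
  qed
  ultimately show D1: "(g1 has_real_derivative g2 t) (at t)" by simp
  have num: "((\<lambda>t. f1 t \<bullet> f1 t + f t \<bullet> f2 t - (g1 t)\<^sup>2) has_real_derivative
      3 * (f1 t \<bullet> f2 t) + f t \<bullet> f3 t - 2 * g1 t * g2 t) (at t)"
    by (auto intro!: derivative_eq_intros inner[OF d2 d2] inner[OF d1 d3] D1 simp: inner_commute[of "f2 t"])
  have "(g2 has_real_derivative ((3 * (f1 t \<bullet> f2 t) + f t \<bullet> f3 t - 2 * g1 t * g2 t) * g t
      - (f1 t \<bullet> f1 t + f t \<bullet> f2 t - (g1 t)\<^sup>2) * g1 t) / (g t * g t)) (at t)"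
    using DERIV_divide[OF num D] gt unfolding g2_def by simp
  moreover have "f1 t \<bullet> f1 t + f t \<bullet> f2 t - (g1 t)\<^sup>2 = g2 t * g t" unfolding g2_def using gt by simp
  ultimately have "(g2 has_real_derivative ((3 * (f1 t \<bullet> f2 t) + f t \<bullet> f3 t - 2 * g1 t * g2 t) * g t
      - (g2 t * g t) * g1 t) / (g t * g t)) (at t)" by simp
  moreover have "((3 * (f1 t \<bullet> f2 t) + f t \<bullet> f3 t - 2 * g1 t * g2 t) * g t
      - (g2 t * g t) * g1 t) / (g t * g t) = g3 t"
  proof -
    have "((A - 2 * b * c) * G - (c * G) * b) / (G * G) = (A - 3 * b * c) / G" if "G > 0" for A b c G :: real
      using that by (simp add: field_simps)
    then show ?thesis using gt by (simp add: g3_def)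
  qed
  ultimately show "(g2 has_real_derivative g3 t) (at t)" by simp
qed

lemma second_order_Taylor_bound:
  fixes g g1 g2 g3 :: "real \<Rightarrow> real"
  assumes d: "d > 0"
    and D: "\<And>t. \<bar>t - x\<bar> \<le> d \<Longrightarrow> (g has_real_derivative g1 t) (at t)"
       "\<And>t. \<bar>t - x\<bar> \<le> d \<Longrightarrow> (g1 has_real_derivative g2 t) (at t)"
       "\<And>t. \<bar>t - x\<bar> \<le> d \<Longrightarrow> (g2 has_real_derivative g3 t) (at t)"
    and cont: "continuous_on {x-d..x+d} g3"
  shows "\<exists>K. \<forall>t. \<bar>t - x\<bar> \<le> d \<longrightarrow> \<bar>g t - (g x + g1 x * (t - x) + g2 x / 2 * (t - x)\<^sup>2)\<bar> \<le> K * \<bar>t - x\<bar> ^ 3"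
proof -
  have "bounded (g3 ` {x-d..x+d})" by (intro compact_imp_bounded compact_continuous_image cont) auto
  then obtain B where "\<forall>t\<in>{x-d..x+d}. \<bar>g3 t\<bar> \<le> B" by (auto simp: bounded_iff)
  then have B: "\<bar>g3 t\<bar> \<le> B" if "t \<in> {x-d..x+d}" for t using that by blast
  define diff where "diff m = (if m = 0 then g else if m = 1 then g1 else if m = 2 then g2 else g3)" for m :: nat
  have DD: "\<forall>m t. m < 3 \<and> x - d \<le> t \<and> t \<le> x + d \<longrightarrow> DERIV (diff m) t :> diff (Suc m) t"
  proof (intro allI impI)
    fix m :: nat and t :: real assume *: "m < 3 \<and> x - d \<le> t \<and> t \<le> x + d"
    then have "m = 0 \<or> m = 1 \<or> m = 2" and "\<bar>t - x\<bar> \<le> d" by auto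
    then show "DERIV (diff m) t :> diff (Suc m) t" using D by (auto simp: diff_def)
  qed
  have "\<bar>g t - (g x + g1 x * (t - x) + g2 x / 2 * (t - x)\<^sup>2)\<bar> \<le> B / 6 * \<bar>t - x\<bar> ^ 3" if t: "\<bar>t - x\<bar> \<le> d" for t
  proof (cases "t = x")
    case False
    have "\<exists>s. (if t < x then t < s \<and> s < x else x < s \<and> s < t) \<and>
      g t = (\<Sum>m<3. (diff m x / fact m) * (t - x) ^ m) + (diff 3 s / fact 3) * (t - x) ^ 3"
      by (rule Taylor[OF _ _ DD]) (use d t False in \<open>simp_all add: diff_def abs_le_iff\<close>)
    then obtain s where s: "if t < x then t < s \<and> s < x else x < s \<and> s < t"
      "g t = (\<Sum>m<3. (diff m x / fact m) * (t - x) ^ m) + (diff 3 s / fact 3) * (t - x) ^ 3" by blast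
    have "g t - (g x + g1 x * (t - x) + g2 x / 2 * (t - x)\<^sup>2) = g3 s / 6 * (t - x) ^ 3"
      unfolding s(2) by (simp add: diff_def eval_nat_numeral)
    moreover have "\<bar>g3 s\<bar> \<le> B" using s(1) t by (intro B) (auto split: if_splits)
    ultimately show ?thesis
      using mult_right_mono[of "\<bar>g3 s\<bar> / 6" "B / 6" "\<bar>t - x\<bar> ^ 3"]
      by (simp only: abs_mult power_abs abs_divide) simp
  qed auto
  then show ?thesis by blast
qed

lemma norm_curve_expansion_at_maximum:
  fixes f f1 f2 f3 :: "real \<Rightarrow> 'a::real_inner"
  assumes d1: "\<And>t. (f has_vector_derivative f1 t) (at t)"
    and d2: "\<And>t. (f1 has_vector_derivative f2 t) (at t)"
    and d3: "\<And>t. (f2 has_vector_derivative f3 t) (at t)"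
    and cont: "continuous_on UNIV f3"
    and nz: "f x \<noteq> 0" and max: "\<And>t. norm (f t) \<le> norm (f x)"
  defines "g \<equiv> \<lambda>t. norm (f t)"
  shows "\<exists>d>0. \<exists>K. \<forall>t. \<bar>t - x\<bar> < d \<longrightarrow> \<bar>g t - (g x + (deriv ^^ 2) g x / 2 * (t - x)\<^sup>2)\<bar> \<le> K * \<bar>t - x\<bar> ^ 3"
proof -
  define g1 where "g1 = (\<lambda>t. (f t \<bullet> f1 t) / norm (f t))"
  define g2 where "g2 = (\<lambda>t. (f1 t \<bullet> f1 t + f t \<bullet> f2 t - (g1 t)\<^sup>2) / norm (f t))"
  define g3 where "g3 = (\<lambda>t. (3 * (f1 t \<bullet> f2 t) + f t \<bullet> f3 t - 3 * g1 t * g2 t) / norm (f t))"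
  have D: "(g has_real_derivative g1 t) (at t)" "(g1 has_real_derivative g2 t) (at t)"
    "(g2 has_real_derivative g3 t) (at t)" if "f t \<noteq> 0" for t
    using norm_curve_has_derivatives[where f = f and ?f1.0 = f1 and ?f2.0 = f2 and ?f3.0 = f3 and t = t, OF d1 d2 d3 that] unfolding g_def g1_def g2_def g3_def by blast+
  have c: "continuous_on S f" "continuous_on S f1" "continuous_on S f2" for S
    using d1 d2 d3 by (auto intro!: continuous_at_imp_continuous_on dest: has_vector_derivative_continuous)
  have "open {t. f t \<noteq> 0}"
    using c(1)[of UNIV] by (intro open_Collect_neq) auto
  then obtain e where e: "e > 0" "ball x e \<subseteq> {t. f t \<noteq> 0}" using nz by (auto simp: open_contains_ball)
  define d where "d = e / 2"
  have d: "d > 0" using e by (simp add: d_def)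
  have nzd: "f t \<noteq> 0" if "\<bar>t - x\<bar> \<le> d" for t
  proof -
    have "t \<in> ball x e" using that e(1) by (simp add: d_def dist_real_def abs_minus_commute)
    then show ?thesis using e(2) by blast
  qed
  have "continuous_on {x-d..x+d} g3" unfolding g3_def g2_def g1_def
    using nzd by (intro continuous_intros c continuous_on_subset[OF cont]) (auto simp: abs_le_iff)
  from second_order_Taylor_bound[OF d D[OF nzd] this]
  obtain K where K: "\<And>t. \<bar>t - x\<bar> \<le> d \<Longrightarrow> \<bar>g t - (g x + g1 x * (t - x) + g2 x / 2 * (t - x)\<^sup>2)\<bar> \<le> K * \<bar>t - x\<bar> ^ 3"
    by blast
  have "g1 x = 0"
    using DERIV_local_max[OF D(1)[OF nz] d] max by (simp add: g_def)
  moreover have "(deriv ^^ 2) g x = g2 x"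
  proof -
    have "eventually (\<lambda>t. deriv g t = g1 t) (nhds x)"
      using D(1) e by (intro eventually_nhds_in_open[of "ball x e", THEN eventually_mono]) (auto intro!: DERIV_imp_deriv)
    then have "deriv (deriv g) x = deriv g1 x" by (intro deriv_cong_ev) auto
    then show ?thesis using D(2)[OF nz] by (simp add: DERIV_imp_deriv numeral_2_eq_2)
  qed
  ultimately show ?thesis using K d by (intro exI[of _ d] exI[of _ K] conjI) auto
qed

section \<open>Periods and exponentials\<close>

lemma integral_over_shifted_period:
  fixes u :: "real \<Rightarrow> 'a::banach"
  assumes "continuous_on UNIV u" "\<And>t. u (t + P) = u t" "0 \<le> p" "p \<le> P"
  shows "integral {p..p+P} u = integral {0..P} u"
proof -
  have int: "u integrable_on {a..b}" for a b
    using assms(1) by (intro integrable_continuous_real) (auto intro: continuous_on_subset)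
  have "integral {0..p} u = integral {0..p} (u \<circ> ((+) P))"
    by (intro arg_cong2[where f = integral] refl ext) (simp add: assms(2) add.commute[of P])
  also have "\<dots> = integral {P..p+P} u" using integral_shift_Icc_real[of 0 p u P] by simp
  finally show ?thesis
    using Henstock_Kurzweil_Integration.integral_combine[OF assms(3,4) int] Henstock_Kurzweil_Integration.integral_combine[of p P "p + P" u] int assms(3,4)
    by (simp add: add.commute)
qed

lemma exp_i_Lipschitz: "cmod (exp (\<i> * of_real t) - exp (\<i> * of_real s)) \<le> 1 * \<bar>t - s\<bar>"
proof -
  have "exp (\<i> * of_real t) - exp (\<i> * of_real s) = exp (\<i> * of_real s) * (exp (\<i> * of_real (t - s)) - 1)"
    by (simp add: right_diff_distrib flip: exp_add)
  then have "cmod (exp (\<i> * of_real t) - exp (\<i> * of_real s)) = 2 * \<bar>sin ((t - s) / 2)\<bar>"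
    by (simp only: norm_mult norm_exp_i_times dist_exp_i_1 mult_1)
  then show ?thesis using abs_sin_x_le_abs_x[of "(t - s) / 2"] by simp
qed

lemma trig_polynomial_has_vector_derivative:
  fixes b :: "nat \<Rightarrow> complex" and m :: "nat \<Rightarrow> nat"
  shows "((\<lambda>t. \<Sum>k\<in>A. b k * exp (\<i> * of_nat (m k) * complex_of_real t)) has_vector_derivative
          (\<Sum>k\<in>A. (b k * (\<i> * of_nat (m k))) * exp (\<i> * of_nat (m k) * complex_of_real t))) (at t)"
proof -
  have "((\<lambda>t. exp (\<i> * of_nat (m k) * complex_of_real t)) has_vector_derivative
      \<i> * of_nat (m k) * exp (\<i> * of_nat (m k) * complex_of_real t)) (at t)" for k
    by (rule has_vector_derivative_real_field) (auto intro!: derivative_eq_intros)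
  then have "((\<lambda>t. b k * exp (\<i> * of_nat (m k) * complex_of_real t)) has_vector_derivative
      b k * (\<i> * of_nat (m k) * exp (\<i> * of_nat (m k) * complex_of_real t))) (at t)" for k
    by (rule has_vector_derivative_mult_right)
  then show ?thesis
    unfolding mult.assoc by (intro has_vector_derivative_sum) (simp add: mult.assoc)
qed

section \<open>The asymptotic expansion\<close>

theorem mainTheorem1:
  fixes n M :: nat
    and m :: "nat \<Rightarrow> nat"
    and a :: "nat \<Rightarrow> complex"
    and f :: "real \<Rightarrow> complex"
    and g :: "real \<Rightarrow> real"
    and \<tau> :: "nat \<Rightarrow> real"
  assumes n: "n \<ge> 1"
    and m_pos: "0 < m 1"
    and m_mono: "strict_mono_on {1..n} m"
    and f_eq: "f = (\<lambda>t. \<Sum>k=1..n. a k * exp (\<i> * of_nat (m k) * complex_of_real t))"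
    and f_nonzero: "\<exists>t. f t \<noteq> 0"
    and g_eq: "g = (\<lambda>t. cmod (f t))"
    and max_points: "bij_betw \<tau> {1..M} {t \<in> {0..<2*pi}. \<forall>s\<in>{0..<2*pi}. g s \<le> g t}"
    and nondegenerate: "\<And>j. j \<in> {1..M} \<Longrightarrow> (deriv ^^ 2) g (\<tau> j) < 0"
  shows "(\<lambda>\<epsilon>.
      integral {0..2*pi}
        (\<lambda>t. complex_of_real (h \<epsilon> (f t / complex_of_real (Linf_norm f))) * exp (\<i> * complex_of_real t))
      - complex_of_real (1 / sqrt \<epsilon>) *
        (\<Sum>j=1..M. complex_of_real pi * exp (\<i> * complex_of_real (\<tau> j)) /
          complex_of_real (sqrt (- ((deriv ^^ 2) g (\<tau> j) / (2 * Linf_norm g))))))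
    \<in> O[at_right 0](\<lambda>\<epsilon>. complex_of_real (1 / \<epsilon> powr (1/4)))"
proof -
  define fd where "fd i t = (\<Sum>k=1..n. a k * (\<i> * of_nat (m k)) ^ i * exp (\<i> * of_nat (m k) * complex_of_real t))"
    for i :: nat and t :: real
  have fd0: "f = fd 0" by (simp add: f_eq fd_def fun_eq_iff)
  have fd: "(fd i has_vector_derivative fd (Suc i) t) (at t)" for i t
    using trig_polynomial_has_vector_derivative[where b = "\<lambda>k. a k * (\<i> * of_nat (m k)) ^ i" and A = "{1..n}" and m = m and t = t]
    unfolding fd_def[abs_def] by (simp add: mult_ac)
  have f_deriv: "(f has_vector_derivative fd 1 t) (at t)" for t using fd[of 0 t] by (simp add: fd0)
  have fd1: "(fd 1 has_vector_derivative fd 2 t) (at t)" for t using fd[of 1 t] by (simp add: numeral_2_eq_2)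
  have fd2: "(fd 2 has_vector_derivative fd 3 t) (at t)" for t using fd[of 2 t] by (simp add: eval_nat_numeral)
  have fd3: "continuous_on UNIV (fd 3)"
    using fd[of 3] by (auto intro!: continuous_at_imp_continuous_on dest: has_vector_derivative_continuous)
  have f_cont: "continuous_on S f" for S
    using f_deriv by (auto intro!: continuous_at_imp_continuous_on dest: has_vector_derivative_continuous)
  have g_cont: "continuous_on S g" for S unfolding g_eq by (intro continuous_intros f_cont)

  have f_per: "f (t + 2 * pi * of_int j) = f t" for t j
  proof -
    have "exp (\<i> * of_nat (m k) * complex_of_real (t + 2 * pi * of_int j)) = exp (\<i> * of_nat (m k) * complex_of_real t)" for k
    proof -
      have "\<i> * of_nat (m k) * complex_of_real (t + 2 * pi * of_int j)
         = \<i> * of_nat (m k) * complex_of_real t + \<i> * (of_int (int (m k) * j) * (of_real pi * 2))"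
        by (simp add: algebra_simps)
      then show ?thesis by (simp only: exp_plus_2pin)
    qed
    then show ?thesis unfolding f_eq by simp
  qed
  have g_per: "g (t + 2 * pi * of_int j) = g t" for t j unfolding g_eq f_per ..
  have g_per1: "g (t + 2 * pi) = g t" "g (t - 2 * pi) = g t" for t
    using g_per[of t 1] g_per[of t "-1"] by auto
  have reduce: "\<exists>s\<in>{0..<2*pi}. g s = g t" for t
  proof
    let ?s = "t + 2 * pi * of_int (- \<lfloor>t / (2 * pi)\<rfloor>)"
    show "g ?s = g t" by (rule g_per)
    have "r * (2 * pi) \<le> t \<and> t < (r + 1) * (2 * pi)" if "r \<le> t / (2 * pi)" "t / (2 * pi) < r + 1" for r
      using that pos_le_divide_eq[of "2 * pi" r t] pos_divide_less_eq[of "2 * pi" t "r + 1"] by simp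
    moreover have "of_int \<lfloor>t / (2 * pi)\<rfloor> \<le> t / (2 * pi)" "t / (2 * pi) < of_int \<lfloor>t / (2 * pi)\<rfloor> + 1"
      by linarith+
    ultimately have "of_int \<lfloor>t / (2 * pi)\<rfloor> * (2 * pi) \<le> t \<and> t < (of_int \<lfloor>t / (2 * pi)\<rfloor> + 1) * (2 * pi)"
      by blast
    then show "?s \<in> {0..<2*pi}" by (simp add: algebra_simps)
  qed

  define N where "N = Linf_norm f"
  have Ng: "Linf_norm g = N" by (simp add: N_def Linf_norm_def g_eq)
  obtain x0 where x0: "x0 \<in> {0..<2*pi}" "g x0 = N" and gN: "\<And>t. g t \<le> N"
  proof -
    have "{0..2*pi} \<noteq> {}" by simp
    from continuous_attains_sup[OF compact_Icc this g_cont]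
    obtain x where x: "x \<in> {0..2*pi}" "\<And>t. t \<in> {0..2*pi} \<Longrightarrow> g t \<le> g x" by blast
    have gx: "g t \<le> g x" for t
    proof -
      obtain s where "s \<in> {0..<2*pi}" "g s = g t" using reduce by blast
      then show ?thesis using x(2)[of s] by simp
    qed
    have "N = g x" unfolding N_def Linf_norm_def using x
      by (intro cSup_eq_maximum) (auto simp: g_eq)
    moreover obtain s where "s \<in> {0..<2*pi}" "g s = g x" using reduce by blast
    ultimately show thesis using gx that by metis
  qed
  have N: "N > 0"
  proof -
    obtain t where "f t \<noteq> 0" using f_nonzero by blast
    then have "g t > 0" by (simp add: g_eq)
    with gN[of t] show ?thesis by linarith
  qed

  define T where "T = {t \<in> {0..<2*pi}. g t = N}"
  have T_eq: "{t \<in> {0..<2*pi}. \<forall>s\<in>{0..<2*pi}. g s \<le> g t} = T"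
    unfolding T_def using x0 gN by (auto intro: order_antisym)
  have \<tau>: "bij_betw \<tau> {1..M} T" using max_points unfolding T_eq .
  have finT: "finite T" using bij_betw_finite[OF \<tau>] by simp
  have neg: "(deriv ^^ 2) g y < 0" if "y \<in> T" for y
    using nondegenerate that bij_betw_imp_surj_on[OF \<tau>] by blast
  obtain p where p: "p \<in> {0..<2*pi}" "p \<notin> T"
  proof -
    have "infinite {0..<2*pi}" by (simp add: infinite_Ico)
    then have "\<not> {0..<2*pi} \<subseteq> T" using finT finite_subset by blast
    then show thesis using that by blast
  qed

  \<comment> \<open>Moving the period to start at the non-maximal point \<open>p\<close> puts every maximum in its interior;
    \<open>\<sigma>\<close> carries the maxima in \<open>[0, 2 pi)\<close> there and \<open>\<rho>\<close> carries them back.\<close>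
  define \<sigma> where "\<sigma> y = (if y < p then y + 2 * pi else y)" for y
  define \<rho> where "\<rho> x = (if x < 2 * pi then x else x - 2 * pi)" for x
  define c where "c y = - ((deriv ^^ 2) g y / (2 * N))" for y
  define F where "F t = 1 - g t / N" for t
  define \<phi> where "\<phi> t = exp (\<i> * complex_of_real t)" for t
  have \<rho>\<sigma>: "\<rho> (\<sigma> y) = y" if "y \<in> T" for y using that p by (auto simp: \<rho>_def \<sigma>_def T_def)
  have \<phi>_per: "\<phi> (t + 2 * pi) = \<phi> t" for t
    using exp_plus_2pin[of "\<i> * complex_of_real t" 1] by (simp add: \<phi>_def algebra_simps)
  have \<phi>\<sigma>: "\<phi> (\<sigma> y) = \<phi> y" for y by (simp add: \<sigma>_def \<phi>_per)
  have g\<rho>: "g (t - x + \<rho> x) = g t" for t x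
    using g_per1[of t] by (simp add: \<rho>_def)

  interpret quadratic_minima \<phi> F p "p + 2 * pi" 1 "\<sigma> ` T" "\<lambda>x. c (\<rho> x)"
  proof
    show "p < p + 2 * pi" by simp
    show "finite (\<sigma> ` T)" using finT by simp
    have "p \<noteq> y" if "y \<in> T" for y using that p by blast
    then show "\<sigma> ` T \<subseteq> {p<..<p + 2 * pi}"
      using p by (force simp: \<sigma>_def T_def)
    show "continuous_on {p..p + 2 * pi} F" unfolding F_def[abs_def] using N by (intro continuous_intros g_cont) auto
    show "0 \<le> F t" for t using gN[of t] N by (simp add: F_def)
    show "0 < F t" if t: "t \<in> {p..p + 2 * pi}" "t \<notin> \<sigma> ` T" for t
    proof -
      have "g t \<noteq> N"
      proof
        assume gt: "g t = N"
        consider "t < 2 * pi" | "2 * pi \<le> t" "t < p + 2 * pi" | "t = p + 2 * pi" using t by force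
        then show False
        proof cases
          case 1
          then have "t \<in> T" "\<sigma> t = t" using gt t p by (auto simp: T_def \<sigma>_def)
          then show False using t(2) by (metis imageI)
        next
          case 2
          then have "t - 2 * pi \<in> T" "\<sigma> (t - 2 * pi) = t" using gt t p g_per1(2)[of t] by (auto simp: T_def \<sigma>_def)
          then show False using t(2) by (metis imageI)
        next
          case 3
          then have "p \<in> T" using gt p g_per1(1)[of p] by (simp add: T_def)
          then show False using p by blast
        qed
      qed
      then show ?thesis using gN[of t] N by (simp add: F_def)
    qed
    show "0 < c (\<rho> x)" if "x \<in> \<sigma> ` T" for x
      using that \<rho>\<sigma> neg N by (auto simp: c_def divide_neg_pos)
    show "cmod (\<phi> t - \<phi> s) \<le> 1 * \<bar>t - s\<bar>" for s t unfolding \<phi>_def by (rule exp_i_Lipschitz)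
    show "\<exists>d>0. \<exists>K. \<forall>t. \<bar>t - x\<bar> < d \<longrightarrow> \<bar>F t - c (\<rho> x) * (t - x)\<^sup>2\<bar> \<le> K * \<bar>t - x\<bar> ^ 3"
      if "x \<in> \<sigma> ` T" for x
    proof -
      define y where "y = \<rho> x"
      have y: "y \<in> T" using that \<rho>\<sigma> by (auto simp: y_def)
      then have gy: "g y = N" by (simp add: T_def)
      have "f y \<noteq> 0" using gy N by (auto simp: g_eq)
      moreover have "norm (f t) \<le> norm (f y)" for t using gN[of t] gy by (simp add: g_eq)
      ultimately obtain d K where d: "d > 0" and K: "\<And>t. \<bar>t - y\<bar> < d \<Longrightarrow>
          \<bar>g t - (g y + (deriv ^^ 2) g y / 2 * (t - y)\<^sup>2)\<bar> \<le> K * \<bar>t - y\<bar> ^ 3"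
        using norm_curve_expansion_at_maximum[OF f_deriv fd1 fd2 fd3, of y] unfolding g_eq by blast
      have "\<bar>F t - c y * (t - x)\<^sup>2\<bar> \<le> K / N * \<bar>t - x\<bar> ^ 3" if "\<bar>t - x\<bar> < d" for t
      proof -
        let ?A = "g t - (N + (deriv ^^ 2) g y / 2 * (t - x)\<^sup>2)"
        have *: "\<bar>?A\<bar> \<le> K * \<bar>t - x\<bar> ^ 3"
          using K[of "t - x + y"] that g\<rho>[of t x, folded y_def] by (simp add: gy)
        have "F t - c y * (t - x)\<^sup>2 = - (?A / N)" using N by (simp add: F_def c_def field_simps)
        then have "\<bar>F t - c y * (t - x)\<^sup>2\<bar> = \<bar>?A\<bar> / N" using N by simp
        also have "\<dots> \<le> K * \<bar>t - x\<bar> ^ 3 / N" using * N by (intro divide_right_mono) auto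
        finally show ?thesis by simp
      qed
      then show ?thesis using d unfolding y_def[symmetric] by blast
    qed
  qed

  have integrand: "complex_of_real (h \<epsilon> (f t / complex_of_real (Linf_norm f))) * exp (\<i> * complex_of_real t)
      = \<phi> t / complex_of_real (\<epsilon> + (1 - \<epsilon>) * F t)" for \<epsilon> t
  proof -
    have "1 - (1 - \<epsilon>) * cmod (f t / complex_of_real N) = \<epsilon> + (1 - \<epsilon>) * F t"
      using N by (simp add: F_def norm_divide g_eq algebra_simps)
    then show ?thesis unfolding h_def N_def[symmetric] \<phi>_def by (simp add: of_real_divide)
  qed
  have sum: "(\<Sum>j=1..M. complex_of_real pi * exp (\<i> * complex_of_real (\<tau> j)) /
          complex_of_real (sqrt (- ((deriv ^^ 2) g (\<tau> j) / (2 * Linf_norm g)))))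
      = (\<Sum>y\<in>\<sigma> ` T. complex_of_real pi * \<phi> y / complex_of_real (sqrt (c (\<rho> y))))"
  proof -
    have "(\<Sum>y\<in>\<sigma> ` T. complex_of_real pi * \<phi> y / complex_of_real (sqrt (c (\<rho> y))))
       = (\<Sum>y\<in>T. complex_of_real pi * \<phi> y / complex_of_real (sqrt (c y)))"
      using inj_on_inverseI[of T \<rho> \<sigma>] \<rho>\<sigma> by (simp add: sum.reindex \<phi>\<sigma>)
    also have "\<dots> = (\<Sum>j=1..M. complex_of_real pi * \<phi> (\<tau> j) / complex_of_real (sqrt (c (\<tau> j))))"
      by (rule sum.reindex_bij_betw[OF \<tau>, symmetric])
    finally show ?thesis unfolding \<phi>_def c_def Ng ..
  qed
  have shift: "integral {0..2*pi} (\<lambda>t. \<phi> t / complex_of_real (\<epsilon> + (1 - \<epsilon>) * F t))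
      = integral {p..p + 2*pi} (\<lambda>t. \<phi> t / complex_of_real (\<epsilon> + (1 - \<epsilon>) * F t))" if "0 < \<epsilon>" "\<epsilon> < 1" for \<epsilon>
  proof -
    have "\<epsilon> + (1 - \<epsilon>) * F t > 0" for t
    proof -
      have "(1 - \<epsilon>) * F t \<ge> 0" using gN[of t] N that by (simp add: F_def)
      then show ?thesis using that by linarith
    qed
    then have nz: "complex_of_real (\<epsilon> + (1 - \<epsilon>) * F t) \<noteq> 0" for t
      by (metis less_irrefl of_real_eq_0_iff)
    have "continuous_on UNIV (\<lambda>t. \<phi> t / complex_of_real (\<epsilon> + (1 - \<epsilon>) * F t))"
      using N nz unfolding \<phi>_def F_def by (intro continuous_intros g_cont) auto
    then show ?thesis
      using p by (intro integral_over_shifted_period[symmetric]) (auto simp: \<phi>_per F_def g_per1)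
  qed
  let ?main = "\<lambda>\<epsilon>. complex_of_real (1 / sqrt \<epsilon>) *
      (\<Sum>y\<in>\<sigma> ` T. complex_of_real pi * \<phi> y / complex_of_real (sqrt (c (\<rho> y))))"
  let ?I = "\<lambda>u v \<epsilon>. integral {u..v} (\<lambda>t. \<phi> t / complex_of_real (\<epsilon> + (1 - \<epsilon>) * F t))"
  have "eventually (\<lambda>\<epsilon>::real. \<epsilon> \<in> {0<..<1}) (at_right 0)"
    by (rule eventually_at_right_real) simp
  then have "eventually (\<lambda>\<epsilon>. ?I 0 (2*pi) \<epsilon> - ?main \<epsilon> = ?I p (p + 2*pi) \<epsilon> - ?main \<epsilon>) (at_right 0)"
    by (rule eventually_mono) (simp only: shift greaterThanLessThan_iff)
  from landau_o.big.in_cong[OF this] show ?thesis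
    unfolding integrand sum using asymptotics by (rule iffD2)
qed

end
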